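(* Let $P$ and $Q$ be equivalence relations on a set $U$. The following are equivalent: (a) $\wp(U)_{P+Q}$ and $\wp(U)^{P+Q}$ are distributive; (b) $P$ and $Q$ are coherent; (c) $\wp(U)_{P+Q}$ and $\wp(U)^{P+Q}$ are completely distributive; (d) $\wp(U)_{P+Q}$ and $\wp(U)^{P+Q}$ are atomistic Boolean lattices.
   Context: For an equivalence relation $E$ on $U$ and $x\in U$, $E(x)=\{y\in U\mid (x,y)\in E\}$. For $X\subseteq U$, $X_{P+Q}=\{x\in U\mid P(x)\subseteq X \text{ or } Q(x)\subseteq X\}$ and $X^{P+Q}=\{x\in U\mid P(x)\cap X\neq\emptyset \text{ and } Q(x)\cap X\neq\emptyset\}$. Let $\wp(U)_{P+Q}=\{X_{P+Q}\mid X\subseteq U\}$ and $\wp(U)^{P+Q}=\{X^{P+Q}\mid X\subseteq U\}$, both ordered by inclusion; these are complete lattices (in $\wp(U)_{P+Q}$ joins are unions and the meet of $\mathcal{H}$ is $(\bigcap\mathcal{H})_{P+Q}$; in $\wp(U)^{P+Q}$ meets are intersections and the join of $\mathcal{H}$ is $(\bigcup\mathcal{H})^{P+Q}$). $P$ and $Q$ are coherent if for every $x\in U$, $P(x)\subseteq Q(x)$ or $Q(x)\subseteq P(x)$. A complete lattice $L$ is completely distributive if $\bigwedge_{i\in I}\bigvee_{j\in J}x_{i,j}=\bigvee_{f\colon I\to J}\bigwedge_{i\in I}x_{i,f(i)}$ for every doubly indexed family $\{x_{i,j}\}_{i\in I,j\in J}$ in $L$. A lattice with least element $0$ is atomistic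 if every element is the join of the atoms below it. *)

theory Defs
  imports "HOL-Algebra.Complete_Lattice"
begin

section \<open>Distributivity, complements and atoms\<close>

locale distributive_lattice = lattice +
  assumes meet_join_distrib:
    "\<lbrakk>x \<in> carrier L; y \<in> carrier L; z \<in> carrier L\<rbrakk>
      \<Longrightarrow> x \<sqinter> (y \<squnion> z) = (x \<sqinter> y) \<squnion> (x \<sqinter> z)"

text \<open>A locale assumption cannot quantify over the types of the index sets.  The index types
  chosen here are large enough: lemma \<open>complete_distrib_arbitrary_index\<close> below derives the law
  for families indexed by sets of arbitrary types.  The index sets may be empty.\<close>

locale completely_distributive_lattice =
  complete_lattice L for L :: "('a, 'b) gorder_scheme" (structure) +
  assumes complete_distrib:
    "\<And>(I :: 'a set set) (J :: 'a set) x.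
      (\<And>i j. \<lbrakk>i \<in> I; j \<in> J\<rbrakk> \<Longrightarrow> x i j \<in> carrier L)
      \<Longrightarrow> (IINF\<^bsub>L\<^esub> i:I. SSUP\<^bsub>L\<^esub> j:J. x i j) = (SSUP\<^bsub>L\<^esub> f:(I \<rightarrow>\<^sub>E J). IINF\<^bsub>L\<^esub> i:I. x i (f i))"

text \<open>The one-element lattice counts as Boolean: \<open>\<bottom> \<noteq> \<top>\<close> is not required.  It
  arises below when \<open>U\<close> is empty.\<close>

locale boolean_lattice = distributive_lattice + bounded_lattice +
  assumes complement_exists:
    "x \<in> carrier L \<Longrightarrow> \<exists>y\<in>carrier L. x \<sqinter> y = \<bottom> \<and> x \<squnion> y = \<top>"

definition atoms :: "('a, 'b) gorder_scheme \<Rightarrow> 'a set" where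
  "atoms L = {a \<in> carrier L. a \<noteq> \<bottom>\<^bsub>L\<^esub> \<and>
     (\<forall>x\<in>carrier L. x \<sqsubseteq>\<^bsub>L\<^esub> a \<longrightarrow> x = \<bottom>\<^bsub>L\<^esub> \<or> x = a)}"

locale atomistic_lattice = lattice + weak_partial_order_bottom +
  assumes join_of_atoms:
    "x \<in> carrier L \<Longrightarrow> is_lub L x {a \<in> atoms L. a \<sqsubseteq> x}"

lemma (in completely_distributive_lattice) complete_distrib_arbitrary_index:
  fixes I :: "'i set" and J :: "'j set"
  assumes x: "\<And>i j. \<lbrakk>i \<in> I; j \<in> J\<rbrakk> \<Longrightarrow> x i j \<in> carrier L"
  shows "(IINF\<^bsub>L\<^esub> i:I. SSUP\<^bsub>L\<^esub> j:J. x i j) = (SSUP\<^bsub>L\<^esub> f:(I \<rightarrow>\<^sub>E J). IINF\<^bsub>L\<^esub> i:I. x i (f i))"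
    (is "?l = ?r")
proof (rule le_antisym)
  have inner: "(IINF\<^bsub>L\<^esub> i:I. x i (f i)) \<in> carrier L" if "f \<in> I \<rightarrow>\<^sub>E J" for f
    unfolding infi_def using that x by (intro inf_closed) (auto simp: PiE_iff)
  have rows: "(SSUP\<^bsub>L\<^esub> j:J. x i j) \<in> carrier L" if "i \<in> I" for i
    unfolding supr_def using that x by (intro sup_closed) auto
  show lc: "?l \<in> carrier L"
    unfolding infi_def using rows by (intro inf_closed) auto
  have sub: "(\<lambda>f. IINF\<^bsub>L\<^esub> i:I. x i (f i)) ` (I \<rightarrow>\<^sub>E J) \<subseteq> carrier L"
    using inner by auto
  show rc: "?r \<in> carrier L"
    unfolding supr_def using sub by (rule sup_closed)
  show "?r \<sqsubseteq> ?l"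
    unfolding supr_def[of L "I \<rightarrow>\<^sub>E J"]
  proof (rule sup_least[OF sub lc], clarify)
    fix f assume f: "f \<in> I \<rightarrow>\<^sub>E J"
    show "(IINF\<^bsub>L\<^esub> i:I. x i (f i)) \<sqsubseteq> ?l"
      unfolding infi_def[of L I "\<lambda>i. supr L J (x i)"]
    proof (rule inf_greatest)
      show "(\<lambda>i. supr L J (x i)) ` I \<subseteq> carrier L" using rows by auto
      show "(IINF\<^bsub>L\<^esub> i:I. x i (f i)) \<in> carrier L" by (rule inner[OF f])
      fix z assume "z \<in> (\<lambda>i. supr L J (x i)) ` I"
      then obtain i where i: "i \<in> I" and z: "z = supr L J (x i)" by auto
      have fi: "f i \<in> J" using f i by auto
      have "(IINF\<^bsub>L\<^esub> i:I. x i (f i)) \<sqsubseteq> x i (f i)"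
        unfolding infi_def using f i x by (intro inf_lower) (auto simp: PiE_iff)
      moreover have "x i (f i) \<sqsubseteq> z"
        unfolding z supr_def using fi i x by (intro sup_upper) auto
      ultimately show "(IINF\<^bsub>L\<^esub> i:I. x i (f i)) \<sqsubseteq> z"
        using le_trans inner[OF f] x[OF i fi] rows[OF i] z by blast
    qed
  qed
  show "?l \<sqsubseteq> ?r"
  proof (cases "J = {}")
    case True
    show ?thesis
    proof (cases "I = {}")
      case True
      have "?r = \<Squnion>\<^bsub>L\<^esub> {\<Sqinter>\<^bsub>L\<^esub> {}}" using True by (simp add: supr_def infi_def)
      also have "\<dots> = \<Sqinter>\<^bsub>L\<^esub> {}" by (intro sup_of_singleton inf_closed) auto
      also have "\<dots> = ?l" using True by (simp add: infi_def)
      finally show ?thesis using lc by simp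
    next
      case False
      have "?l = \<Sqinter>\<^bsub>L\<^esub> {\<Squnion>\<^bsub>L\<^esub> {}}" using False True \<open>J = {}\<close> by (simp add: supr_def infi_def image_constant_conv)
      also have "\<dots> = \<Squnion>\<^bsub>L\<^esub> {}" by (intro inf_of_singleton sup_closed) auto
      also have "\<dots> = ?r" using False \<open>J = {}\<close> by (auto simp: supr_def PiE_eq_empty_iff)
      finally show ?thesis using rc by simp
    qed
  next
    case False
    define A where "A i = x i ` J" for i
    define y where "y B a = (if a \<in> B then a else (SOME b. b \<in> B))" for B and a :: 'a
    have yA: "y (A i) a \<in> A i" if "i \<in> I" for i a
      using False by (auto simp: y_def A_def intro: someI)
    have img: "y (A i) ` carrier L = A i" if i: "i \<in> I" for i
    proof
      show "y (A i) ` carrier L \<subseteq> A i" using yA[OF i] by auto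
      show "A i \<subseteq> y (A i) ` carrier L"
      proof
        fix a assume a: "a \<in> A i"
        then have "a \<in> carrier L" using x[OF i] by (auto simp: A_def)
        moreover have "a = y (A i) a" using a by (simp add: y_def)
        ultimately show "a \<in> y (A i) ` carrier L" by blast
      qed
    qed
    have yc: "y B a \<in> carrier L" if BI: "B \<in> A ` I" for B a
    proof -
      obtain i where i: "i \<in> I" and B: "B = A i" using BI by auto
      have "A i \<subseteq> carrier L" using x[OF i] by (auto simp: A_def)
      then show ?thesis using yA[OF i, of a] B by auto
    qed
    have "?l = (IINF\<^bsub>L\<^esub> B:(A ` I). SSUP\<^bsub>L\<^esub> a:carrier L. y B a)"
      unfolding infi_def supr_def image_image
      by (rule arg_cong[where f = "Lattice.inf L"], rule image_cong[OF HOL.refl])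
         (simp add: img, simp add: A_def)
    also have "\<dots> = (SSUP\<^bsub>L\<^esub> g:(A ` I \<rightarrow>\<^sub>E carrier L). IINF\<^bsub>L\<^esub> B:(A ` I). y B (g B))"
      by (rule complete_distrib) (rule yc)
    also have "\<dots> \<sqsubseteq> ?r"
      unfolding supr_def[of L "A ` I \<rightarrow>\<^sub>E carrier L"]
    proof (rule sup_least[OF _ rc], safe)
      fix g
      show "(IINF\<^bsub>L\<^esub> B:(A ` I). y B (g B)) \<in> carrier L"
        unfolding infi_def using yc by (intro inf_closed) auto
      have "\<exists>j\<in>J. x i j = y (A i) (g (A i))" if "i \<in> I" for i
      proof -
        have "y (A i) (g (A i)) \<in> x i ` J"
          using yA[OF that, of "g (A i)"] by (simp only: A_def)
        then show ?thesis by (metis imageE)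
      qed
      then obtain h where h: "\<And>i. i \<in> I \<Longrightarrow> h i \<in> J"
          "\<And>i. i \<in> I \<Longrightarrow> x i (h i) = y (A i) (g (A i))"
        by metis
      define f where "f = restrict h I"
      have f: "f \<in> I \<rightarrow>\<^sub>E J" using h by (auto simp: f_def)
      have "(IINF\<^bsub>L\<^esub> B:(A ` I). y B (g B)) = (IINF\<^bsub>L\<^esub> i:I. x i (f i))"
        unfolding infi_def image_image using h
        by (intro arg_cong[where f = "Lattice.inf L"] image_cong) (auto simp: f_def)
      also have "\<dots> \<sqsubseteq> ?r"
        unfolding supr_def using f sub by (intro sup_upper) auto
      finally show "(IINF\<^bsub>L\<^esub> B:(A ` I). y B (g B)) \<sqsubseteq> ?r" .
    qed
    finally show ?thesis .
  qed
qed

section \<open>Approximations by two equivalence relations\<close>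

text \<open>The equivalence class \<open>P(x)\<close> is the relational image \<open>P `` {x}\<close>.\<close>

definition lower_approx :: "'a set \<Rightarrow> 'a rel \<Rightarrow> 'a rel \<Rightarrow> 'a set \<Rightarrow> 'a set" where
  "lower_approx U P Q X = {x \<in> U. P `` {x} \<subseteq> X \<or> Q `` {x} \<subseteq> X}"

definition upper_approx :: "'a set \<Rightarrow> 'a rel \<Rightarrow> 'a rel \<Rightarrow> 'a set \<Rightarrow> 'a set" where
  "upper_approx U P Q X = {x \<in> U. P `` {x} \<inter> X \<noteq> {} \<and> Q `` {x} \<inter> X \<noteq> {}}"

definition lower_approx_lattice :: "'a set \<Rightarrow> 'a rel \<Rightarrow> 'a rel \<Rightarrow> 'a set gorder" where
  "lower_approx_lattice U P Q =
     \<lparr>carrier = {lower_approx U P Q X | X. X \<subseteq> U}, eq = (=), le = (\<subseteq>)\<rparr>"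

definition upper_approx_lattice :: "'a set \<Rightarrow> 'a rel \<Rightarrow> 'a rel \<Rightarrow> 'a set gorder" where
  "upper_approx_lattice U P Q =
     \<lparr>carrier = {upper_approx U P Q X | X. X \<subseteq> U}, eq = (=), le = (\<subseteq>)\<rparr>"

definition coherent :: "'a set \<Rightarrow> 'a rel \<Rightarrow> 'a rel \<Rightarrow> bool" where
  "coherent U P Q \<longleftrightarrow> (\<forall>x\<in>U. P `` {x} \<subseteq> Q `` {x} \<or> Q `` {x} \<subseteq> P `` {x})"

end

theory Submission
  imports Defs
begin

text \<open>If \<open>P\<close> and \<open>Q\<close> are coherent, then the smaller of \<open>P(x)\<close> and \<open>Q(x)\<close> is the class of \<open>x\<close>
  under the equivalence relation \<open>P \<inter> Q\<close>.  Both approximations are therefore the ordinary rough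
  approximations by \<open>P \<inter> Q\<close>, and both lattices are the complete field of sets consisting of all
  unions of classes of \<open>P \<inter> Q\<close>.  Conversely, suppose that \<open>P(x)\<close> and \<open>Q(x)\<close> are incomparable.
  Put \<open>A = P(x)\<close>, \<open>B = Q(x)\<close> and let \<open>C\<close> be the union of the \<open>Q\<close>-classes of the points of
  \<open>A - B\<close>.  In the lattice of lower approximations \<open>A\<close> lies below the join of \<open>B\<close> and \<open>C\<close>, but
  the meet of \<open>A\<close> and \<open>B\<close> is empty, because the intersection of \<open>A\<close> and \<open>B\<close> contains no
  \<open>P\<close>-class and no \<open>Q\<close>-class, and \<open>C\<close> misses the point \<open>x\<close> of \<open>A\<close>.  So distributivity fails.\<close>

section \<open>Complete distributivity implies distributivity\<close>

sublocale completely_distributive_lattice \<subseteq> distributive_lattice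
proof unfold_locales
  fix x y z assume xyz: "x \<in> carrier L" "y \<in> carrier L" "z \<in> carrier L"
  \<comment> \<open>Row \<open>True\<close> is constantly \<open>x\<close> and row
    \<open>False\<close> consists of \<open>y\<close> and \<open>z\<close>. The infimum along a
    choice function \<open>f\<close> therefore depends on \<open>f False\<close> only.\<close>
  define u where "u i j = (if i then x else if j then y else z)" for i j :: bool
  have "x \<sqinter> (y \<squnion> z) = (IINF i:UNIV. SSUP j:UNIV. u i j)"
  proof -
    have "(SSUP j:UNIV. u True j) = x" "(SSUP j:UNIV. u False j) = y \<squnion> z"
      using xyz by (simp_all add: u_def supr_def join_def UNIV_bool insert_commute)
    then show ?thesis
      by (simp add: infi_def meet_def UNIV_bool insert_commute)
  qed
  also have "\<dots> = (SSUP f:(UNIV \<rightarrow>\<^sub>E UNIV). IINF i:UNIV. u i (f i))"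
    by (rule complete_distrib_arbitrary_index) (simp add: u_def xyz)
  also have "\<dots> = (x \<sqinter> y) \<squnion> (x \<sqinter> z)"
  proof -
    have "(IINF i:UNIV. u i (f i)) = (if f False then x \<sqinter> y else x \<sqinter> z)" for f
      by (simp add: u_def infi_def meet_def UNIV_bool insert_commute)
    moreover have "range (\<lambda>f :: bool \<Rightarrow> bool. if f False then x \<sqinter> y else x \<sqinter> z) = {x \<sqinter> y, x \<sqinter> z}"
    proof (intro equalityI subsetI)
      fix w assume "w \<in> {x \<sqinter> y, x \<sqinter> z}"
      then show "w \<in> range (\<lambda>f :: bool \<Rightarrow> bool. if f False then x \<sqinter> y else x \<sqinter> z)"
        by (auto intro: rev_image_eqI[where x = "\<lambda>_. True"] rev_image_eqI[where x = "\<lambda>_. False"])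
    qed auto
    ultimately show ?thesis
      by (simp add: supr_def join_def)
  qed
  finally show "x \<sqinter> (y \<squnion> z) = (x \<sqinter> y) \<squnion> (x \<sqinter> z)" .
qed

section \<open>Complete fields of sets\<close>

text \<open>Unions and complements suffice: the empty union gives the empty set, and De Morgan gives
  intersections.\<close>

locale complete_field_of_sets =
  fixes U :: "'a set" and S :: "'a set set"
  assumes subset_space: "X \<in> S \<Longrightarrow> X \<subseteq> U"
    and Union_closed: "\<A> \<subseteq> S \<Longrightarrow> \<Union>\<A> \<in> S"
    and compl_closed: "X \<in> S \<Longrightarrow> U - X \<in> S"
begin

abbreviation L :: "'a set gorder" where "L \<equiv> \<lparr>carrier = S, eq = (=), le = (\<subseteq>)\<rparr>"

lemma space_closed: "U \<in> S"
  using compl_closed[of "{}"] Union_closed[of "{}"] by simp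

text \<open>Intersecting with \<open>U\<close> makes the empty family yield \<open>U\<close>, the
  top element, instead of the whole type.\<close>

lemma Inter_closed:
  assumes "\<A> \<subseteq> S"
  shows "U \<inter> \<Inter>\<A> \<in> S"
proof -
  have "U \<inter> \<Inter>\<A> = U - \<Union>((\<lambda>X. U - X) ` \<A>)"
    by auto
  also have "\<dots> \<in> S"
    using assms by (intro compl_closed Union_closed) (auto intro: compl_closed)
  finally show ?thesis .
qed

lemma is_lub_Union: "\<A> \<subseteq> S \<Longrightarrow> is_lub L (\<Union>\<A>) \<A>"
  by (auto simp: least_def Upper_def intro: Union_closed)

lemma is_glb_Inter: "\<A> \<subseteq> S \<Longrightarrow> is_glb L (U \<inter> \<Inter>\<A>) \<A>"
  using subset_space by (fastforce simp: greatest_def Lower_def intro: Inter_closed)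

sublocale complete_lattice L
  by unfold_locales (auto intro: is_lub_Union is_glb_Inter)

lemma sup_eq_Union: "\<A> \<subseteq> S \<Longrightarrow> \<Squnion>\<^bsub>L\<^esub>\<A> = \<Union>\<A>"
  using least_unique[OF _ is_lub_Union] supI[of \<A> "\<lambda>l. l = \<Union>\<A>"] by auto

lemma inf_eq_Inter: "\<A> \<subseteq> S \<Longrightarrow> \<Sqinter>\<^bsub>L\<^esub>\<A> = U \<inter> \<Inter>\<A>"
  using greatest_unique[OF _ is_glb_Inter] infI[of \<A> "\<lambda>l. l = U \<inter> \<Inter>\<A>"] by auto

lemma bottom_eq_empty: "\<bottom>\<^bsub>L\<^esub> = {}"
  using bottom_lower[of "{}"] Union_closed[of "{}"] by simp

lemma top_eq_space: "\<top>\<^bsub>L\<^esub> = U"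
  using top_higher[of U] top_closed space_closed subset_space by auto

sublocale completely_distributive_lattice L
proof unfold_locales
  fix I :: "'a set set set" and J :: "'a set set" and x
  assume x: "\<And>i j. \<lbrakk>i \<in> I; j \<in> J\<rbrakk> \<Longrightarrow> x i j \<in> carrier L"
  have rows: "(SSUP\<^bsub>L\<^esub> j:J. x i j) = (\<Union>j\<in>J. x i j)" if "i \<in> I" for i
    using x that by (auto simp: supr_def sup_eq_Union image_subset_iff)
  have cols: "(IINF\<^bsub>L\<^esub> i:I. x i (f i)) = U \<inter> (\<Inter>i\<in>I. x i (f i))"
    if "f \<in> I \<rightarrow>\<^sub>E J" for f
    using x that by (simp add: infi_def inf_eq_Inter image_subset_iff PiE_iff)
  have "(IINF\<^bsub>L\<^esub> i:I. SSUP\<^bsub>L\<^esub> j:J. x i j) = \<Sqinter>\<^bsub>L\<^esub>((\<lambda>i. \<Union>j\<in>J. x i j) ` I)"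
    unfolding infi_def using rows by (simp cong: image_cong)
  also have "\<dots> = U \<inter> (\<Inter>i\<in>I. \<Union>j\<in>J. x i j)"
    using x by (intro inf_eq_Inter) (auto intro!: Union_closed)
  also have "\<dots> = (\<Union>f\<in>I \<rightarrow>\<^sub>E J. U \<inter> (\<Inter>i\<in>I. x i (f i)))"
  proof (intro equalityI subsetI)
    fix u assume u: "u \<in> U \<inter> (\<Inter>i\<in>I. \<Union>j\<in>J. x i j)"
    then have "\<forall>i\<in>I. \<exists>j\<in>J. u \<in> x i j"
      by auto
    \<comment> \<open>The point \<open>u\<close> itself selects the choice function: in each row it
      lies in some entry. Restricting \<open>g\<close> to \<open>I\<close> makes it extensional, as
      membership in \<open>I \<rightarrow>\<^sub>E J\<close> demands.\<close>
    then obtain g where "\<forall>i\<in>I. g i \<in> J \<and> u \<in> x i (g i)"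
      by metis
    then have "restrict g I \<in> I \<rightarrow>\<^sub>E J" "u \<in> U \<inter> (\<Inter>i\<in>I. x i (restrict g I i))"
      using u by auto
    then show "u \<in> (\<Union>f\<in>I \<rightarrow>\<^sub>E J. U \<inter> (\<Inter>i\<in>I. x i (f i)))"
      by blast
  qed (fastforce simp: PiE_iff)
  also have "\<dots> = \<Squnion>\<^bsub>L\<^esub>((\<lambda>f. U \<inter> (\<Inter>i\<in>I. x i (f i))) ` (I \<rightarrow>\<^sub>E J))"
    using x by (intro sup_eq_Union[symmetric]) (auto intro!: Inter_closed simp: PiE_iff)
  also have "\<dots> = (SSUP\<^bsub>L\<^esub> f:(I \<rightarrow>\<^sub>E J). IINF\<^bsub>L\<^esub> i:I. x i (f i))"
    unfolding supr_def using cols by (simp cong: image_cong)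
  finally show "(IINF\<^bsub>L\<^esub> i:I. SSUP\<^bsub>L\<^esub> j:J. x i j) =
    (SSUP\<^bsub>L\<^esub> f:(I \<rightarrow>\<^sub>E J). IINF\<^bsub>L\<^esub> i:I. x i (f i))" .
qed

sublocale boolean_lattice L
proof unfold_locales
  fix X assume X: "X \<in> carrier L"
  have "X \<sqinter>\<^bsub>L\<^esub> (U - X) = \<bottom>\<^bsub>L\<^esub>" "X \<squnion>\<^bsub>L\<^esub> (U - X) = \<top>\<^bsub>L\<^esub>"
    using X compl_closed subset_space[of X]
    by (auto simp: meet_def join_def inf_eq_Inter sup_eq_Union bottom_eq_empty top_eq_space)
  then show "\<exists>Y\<in>carrier L. X \<sqinter>\<^bsub>L\<^esub> Y = \<bottom>\<^bsub>L\<^esub> \<and> X \<squnion>\<^bsub>L\<^esub> Y = \<top>\<^bsub>L\<^esub>"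
    using X compl_closed by auto
qed

text \<open>For \<open>x\<close> in \<open>U\<close> this is the least member of \<open>S\<close>
  containing \<open>x\<close>; such cells supply the atoms below a given set.\<close>

definition cell :: "'a \<Rightarrow> 'a set" where
  "cell x = U \<inter> \<Inter>{X \<in> S. x \<in> X}"

lemma mem_cell: "x \<in> U \<Longrightarrow> x \<in> cell x"
  by (simp add: cell_def)

lemma cell_subset: "X \<in> S \<Longrightarrow> x \<in> X \<Longrightarrow> cell x \<subseteq> X"
  by (auto simp: cell_def)

text \<open>A member of \<open>S\<close> cannot split a cell: either it contains \<open>x\<close>,
  and with it the whole cell, or its complement does.\<close>

lemma cell_in_atoms:
  assumes "x \<in> U"
  shows "cell x \<in> atoms L"
proof -
  have "Y = {} \<or> Y = cell x" if Y: "Y \<in> S" "Y \<subseteq> cell x" for Y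
  proof (cases "x \<in> Y")
    case True
    then show ?thesis using Y cell_subset by blast
  next
    case False
    then have "cell x \<subseteq> U - Y"
      using assms Y by (intro cell_subset compl_closed) auto
    then show ?thesis using Y by blast
  qed
  moreover have "cell x \<in> S"
    unfolding cell_def by (rule Inter_closed) auto
  ultimately show ?thesis
    using mem_cell[OF assms] by (auto simp: atoms_def bottom_eq_empty)
qed

sublocale atomistic_lattice L
proof unfold_locales
  fix X assume X: "X \<in> carrier L"
  have "\<Union>{a \<in> atoms L. a \<sqsubseteq>\<^bsub>L\<^esub> X} = X"
  proof (intro equalityI subsetI)
    fix x assume "x \<in> X"
    then have "cell x \<in> atoms L" "x \<in> cell x" "cell x \<subseteq> X"
      using X subset_space cell_in_atoms mem_cell cell_subset by auto
    then show "x \<in> \<Union>{a \<in> atoms L. a \<sqsubseteq>\<^bsub>L\<^esub> X}" by auto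
  qed auto
  then show "is_lub L X {a \<in> atoms L. a \<sqsubseteq>\<^bsub>L\<^esub> X}"
    using is_lub_Union[of "{a \<in> atoms L. a \<sqsubseteq>\<^bsub>L\<^esub> X}"] by (auto simp: atoms_def)
qed

end

section \<open>The lattices of approximations\<close>

lemma equiv_Int: "equiv U P \<Longrightarrow> equiv U Q \<Longrightarrow> equiv U (P \<inter> Q)"
  unfolding equiv_def by (auto intro: sym_Int trans_Int dest: refl_on_Int)

lemma equiv_Image_subset: "equiv U R \<Longrightarrow> R `` X \<subseteq> U"
  by (auto dest: equiv_type)

lemma equiv_Image_closed: "equiv U R \<Longrightarrow> y \<in> R `` X \<Longrightarrow> R `` {y} \<subseteq> R `` X"
  by (auto simp: equiv_def dest: transD)

text \<open>The members are the unions of classes of \<open>R\<close>. Complements stay saturated by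
  symmetry: a step from \<open>U - X\<close> into \<open>X\<close> could be reversed, leaving
  \<open>X\<close>.\<close>

lemma complete_field_of_saturated_sets:
  assumes "equiv U R"
  shows "complete_field_of_sets U {X. X \<subseteq> U \<and> R `` X \<subseteq> X}"
proof
  fix X assume X: "X \<in> {X. X \<subseteq> U \<and> R `` X \<subseteq> X}"
  then show "U - X \<in> {X. X \<subseteq> U \<and> R `` X \<subseteq> X}"
    using assms unfolding equiv_def by (blast dest: symD)
qed blast+

section \<open>The coherent case: reduction to one equivalence relation\<close>

lemma coherent_class_eq:
  assumes "coherent U P Q" "x \<in> U"
  shows "P `` {x} = (P \<inter> Q) `` {x} \<and> (P \<inter> Q) `` {x} \<subseteq> Q `` {x} \<or>
    Q `` {x} = (P \<inter> Q) `` {x} \<and> (P \<inter> Q) `` {x} \<subseteq> P `` {x}"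
  using assms by (auto simp: coherent_def)

text \<open>At each point the smaller class decides. It lies in \<open>X\<close> whenever the larger
  one does, which settles the disjunction; and if it meets \<open>X\<close>, so does the larger one,
  which settles the conjunction.\<close>

lemma coherent_approx:
  assumes "coherent U P Q"
  shows "lower_approx U P Q X = {x \<in> U. (P \<inter> Q) `` {x} \<subseteq> X}"
    and "upper_approx U P Q X = {x \<in> U. (P \<inter> Q) `` {x} \<inter> X \<noteq> {}}"
  using coherent_class_eq[OF assms] unfolding lower_approx_def upper_approx_def
  by blast+

text \<open>Both operators take values in \<open>S\<close> and fix every member of \<open>S\<close>,
  so \<open>S\<close> is the range of each.\<close>

lemma coherent_lattices:
  assumes P: "equiv U P" and Q: "equiv U Q" and "coherent U P Q"
  defines "S \<equiv> {X. X \<subseteq> U \<and> (P \<inter> Q) `` X \<subseteq> X}"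
  shows "lower_approx_lattice U P Q = \<lparr>carrier = S, eq = (=), le = (\<subseteq>)\<rparr>"
    and "upper_approx_lattice U P Q = \<lparr>carrier = S, eq = (=), le = (\<subseteq>)\<rparr>"
proof -
  define R where "R = P \<inter> Q"
  have "equiv U R"
    using equiv_Int[OF P Q] by (simp add: R_def)
  then have R: "refl_on U R" "sym R" "trans R" and RU: "R \<subseteq> U \<times> U"
    by (simp_all add: equiv_def)
  have S: "S = {X. X \<subseteq> U \<and> R `` X \<subseteq> X}"
    by (simp add: S_def R_def)
  have lower: "{x \<in> U. R `` {x} \<subseteq> X} \<in> S" for X
    using R(3) RU by (auto simp: S dest: transD)
  have upper: "{x \<in> U. R `` {x} \<inter> X \<noteq> {}} \<in> S" for X
  proof -
    have "R `` {x} = R `` {y}" if "(x, y) \<in> R" for x y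
      using equiv_class_eq[OF \<open>equiv U R\<close> that] .
    then show ?thesis using RU unfolding S by blast
  qed
  have fixed: "{x \<in> U. R `` {x} \<subseteq> X} = X" "{x \<in> U. R `` {x} \<inter> X \<noteq> {}} = X" if "X \<in> S" for X
  proof -
    have X: "X \<subseteq> U" "R `` X \<subseteq> X" using that by (simp_all add: S)
    then show "{x \<in> U. R `` {x} \<subseteq> X} = X"
      using equiv_class_self[OF \<open>equiv U R\<close>] by blast
    show "{x \<in> U. R `` {x} \<inter> X \<noteq> {}} = X"
      using X equiv_class_self[OF \<open>equiv U R\<close>] symD[OF R(2)] by blast
  qed
  have SU: "X \<subseteq> U" if "X \<in> S" for X
    using that by (simp add: S_def)
  have "{{x \<in> U. R `` {x} \<subseteq> X} | X. X \<subseteq> U} = S"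
    using lower fixed(1) SU by blast
  then show "lower_approx_lattice U P Q = \<lparr>carrier = S, eq = (=), le = (\<subseteq>)\<rparr>"
    by (simp add: lower_approx_lattice_def coherent_approx[OF assms(3)] R_def)
  have "{{x \<in> U. R `` {x} \<inter> X \<noteq> {}} | X. X \<subseteq> U} = S"
    using upper fixed(2) SU by blast
  then show "upper_approx_lattice U P Q = \<lparr>carrier = S, eq = (=), le = (\<subseteq>)\<rparr>"
    by (simp add: upper_approx_lattice_def coherent_approx[OF assms(3)] R_def)
qed

lemma coherent_complete_field:
  assumes P: "equiv U P" and Q: "equiv U Q" and "coherent U P Q"
  obtains S where "complete_field_of_sets U S"
    "lower_approx_lattice U P Q = \<lparr>carrier = S, eq = (=), le = (\<subseteq>)\<rparr>"
    "upper_approx_lattice U P Q = \<lparr>carrier = S, eq = (=), le = (\<subseteq>)\<rparr>"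
proof
  show "complete_field_of_sets U {X. X \<subseteq> U \<and> (P \<inter> Q) `` X \<subseteq> X}"
    by (rule complete_field_of_saturated_sets[OF equiv_Int[OF P Q]])
qed (use coherent_lattices[OF assms] in auto)

section \<open>The incoherent case: failure of distributivity\<close>

lemma carrier_lower_approx_lattice:
  assumes P: "equiv U P" and Q: "equiv U Q"
  shows "Y \<in> carrier (lower_approx_lattice U P Q) \<longleftrightarrow>
    Y \<subseteq> U \<and> (\<forall>y\<in>Y. P `` {y} \<subseteq> Y \<or> Q `` {y} \<subseteq> Y)"
proof
  assume "Y \<in> carrier (lower_approx_lattice U P Q)"
  then obtain X where Y: "Y = lower_approx U P Q X"
    by (auto simp: lower_approx_lattice_def)
  \<comment> \<open>All points of a class share that class, so a class inside \<open>X\<close>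
    passes the test for \<open>Y\<close> at each of its points.\<close>
  have "P `` {y} \<subseteq> Y" if "y \<in> U" "P `` {y} \<subseteq> X" for y
    using that equiv_class_eq[OF P] equiv_Image_subset[OF P, of "{y}"]
    by (auto simp: Y lower_approx_def)
  moreover have "Q `` {y} \<subseteq> Y" if "y \<in> U" "Q `` {y} \<subseteq> X" for y
    using that equiv_class_eq[OF Q] equiv_Image_subset[OF Q, of "{y}"]
    by (auto simp: Y lower_approx_def)
  ultimately show "Y \<subseteq> U \<and> (\<forall>y\<in>Y. P `` {y} \<subseteq> Y \<or> Q `` {y} \<subseteq> Y)"
    unfolding Y by (auto simp: lower_approx_def)
next
  assume Y: "Y \<subseteq> U \<and> (\<forall>y\<in>Y. P `` {y} \<subseteq> Y \<or> Q `` {y} \<subseteq> Y)"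
  then have "Y = lower_approx U P Q Y"
    using equiv_class_self[OF P] equiv_class_self[OF Q] by (auto simp: lower_approx_def)
  then show "Y \<in> carrier (lower_approx_lattice U P Q)"
    using Y by (auto simp: lower_approx_lattice_def)
qed

lemma distributive_imp_coherent:
  assumes P: "equiv U P" and Q: "equiv U Q"
    and "distributive_lattice (lower_approx_lattice U P Q)"
  shows "coherent U P Q"
  unfolding coherent_def
proof (intro ballI, rule ccontr)
  define Lo where "Lo = lower_approx_lattice U P Q"
  interpret distributive_lattice Lo
    using assms(3) by (simp add: Lo_def)
  note carrier = carrier_lower_approx_lattice[OF P Q, folded Lo_def]
  have le: "X \<sqsubseteq>\<^bsub>Lo\<^esub> Y \<longleftrightarrow> X \<subseteq> Y" for X Y
    by (simp add: Lo_def lower_approx_lattice_def)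
  fix x assume x: "x \<in> U" and incomparable: "\<not> (P `` {x} \<subseteq> Q `` {x} \<or> Q `` {x} \<subseteq> P `` {x})"
  define A where "A = P `` {x}"
  define B where "B = Q `` {x}"
  define C where "C = Q `` (A - B)"
  have P_closed: "P `` X \<in> carrier Lo" for X
    using equiv_Image_subset[OF P] equiv_Image_closed[OF P] unfolding carrier by blast
  have Q_closed: "Q `` X \<in> carrier Lo" for X
    using equiv_Image_subset[OF Q] equiv_Image_closed[OF Q] unfolding carrier by blast
  note A = P_closed[of "{x}", folded A_def]
  note B = Q_closed[of "{x}", folded B_def]
  note C = Q_closed[of "A - B", folded C_def]
  have cover: "A \<subseteq> B \<union> C"
    using equiv_class_self[OF Q] A unfolding C_def carrier by blast
  \<comment> \<open>Only bounds are needed: as the order is inclusion, a join contains the union of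
    its arguments, and below a meet lies inside their intersection.\<close>
  have "B \<subseteq> B \<squnion>\<^bsub>Lo\<^esub> C" "C \<subseteq> B \<squnion>\<^bsub>Lo\<^esub> C"
    using B C join_left[of B C] join_right[of B C] by (simp_all add: le)
  then have "A \<subseteq> B \<squnion>\<^bsub>Lo\<^esub> C"
    using cover by blast
  then have "A \<subseteq> A \<sqinter>\<^bsub>Lo\<^esub> (B \<squnion>\<^bsub>Lo\<^esub> C)"
    using meet_le[OF _ _ A join_closed[OF B C] A] by (simp add: le)
  also have "\<dots> = (A \<sqinter>\<^bsub>Lo\<^esub> B) \<squnion>\<^bsub>Lo\<^esub> (A \<sqinter>\<^bsub>Lo\<^esub> C)"
    by (rule meet_join_distrib[OF A B C])
  also have "\<dots> \<subseteq> C"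
  proof -
    have sub: "A \<sqinter>\<^bsub>Lo\<^esub> B \<subseteq> A \<inter> B"
      using meet_left[of A B] meet_right[of A B] A B by (simp add: le)
    have "A \<sqinter>\<^bsub>Lo\<^esub> B = {}"
    proof (rule ccontr)
      assume "A \<sqinter>\<^bsub>Lo\<^esub> B \<noteq> {}"
      then obtain w where w: "w \<in> A \<sqinter>\<^bsub>Lo\<^esub> B" by blast
      \<comment> \<open>The meet belongs to the carrier, so with \<open>w\<close> it contains a
        whole class of \<open>w\<close>. That class is \<open>A\<close> or \<open>B\<close>, and its
        lying in \<open>A \<inter> B\<close> would make the two comparable.\<close>
      then have "P `` {w} \<subseteq> A \<inter> B \<or> Q `` {w} \<subseteq> A \<inter> B"
        using meet_closed[OF A B] sub unfolding carrier by blast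
      moreover have "P `` {w} = A" "Q `` {w} = B"
        using w sub equiv_class_eq[OF P, of x w] equiv_class_eq[OF Q, of x w]
        by (auto simp: A_def B_def)
      ultimately show False
        using incomparable by (auto simp: A_def B_def)
    qed
    then show ?thesis
      using join_le[OF _ _ meet_closed[OF A B] meet_closed[OF A C] C] meet_right[OF A C]
      by (simp add: le)
  qed
  finally have "x \<in> C"
    using equiv_class_self[OF P x] by (auto simp: A_def)
  \<comment> \<open>Membership of \<open>x\<close> in \<open>C\<close> makes \<open>x\<close>
    related by \<open>Q\<close> to a point of \<open>A - B\<close>, which would then lie in
    \<open>B\<close>.\<close>
  then show False
    using Q by (auto simp: C_def B_def equiv_def dest: symD)
qed

theorem corollary2p8:
  fixes U :: "'a set" and P Q :: "'a rel"
  assumes "equiv U P" and "equiv U Q"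
  shows "let Lo = lower_approx_lattice U P Q;
             Up = upper_approx_lattice U P Q;
             a = distributive_lattice Lo \<and> distributive_lattice Up;
             b = coherent U P Q;
             c = completely_distributive_lattice Lo \<and> completely_distributive_lattice Up;
             d = (atomistic_lattice Lo \<and> boolean_lattice Lo) \<and>
                 (atomistic_lattice Up \<and> boolean_lattice Up)
         in (a \<longleftrightarrow> b) \<and> (b \<longleftrightarrow> c) \<and> (c \<longleftrightarrow> d)"
proof -
  let ?Lo = "lower_approx_lattice U P Q"
  let ?Up = "upper_approx_lattice U P Q"
  have ab: "coherent U P Q" if "distributive_lattice ?Lo"
    using distributive_imp_coherent[OF assms that] .
  have bcd: "completely_distributive_lattice ?Lo \<and> completely_distributive_lattice ?Up \<and>
      (atomistic_lattice ?Lo \<and> boolean_lattice ?Lo) \<and> (atomistic_lattice ?Up \<and> boolean_lattice ?Up)"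
    if coh: "coherent U P Q"
  proof -
    obtain S where "complete_field_of_sets U S"
      and eq: "?Lo = \<lparr>carrier = S, eq = (=), le = (\<subseteq>)\<rparr>" "?Up = \<lparr>carrier = S, eq = (=), le = (\<subseteq>)\<rparr>"
      using coherent_complete_field[OF assms coh] .
    then interpret complete_field_of_sets U S by simp
    show ?thesis
      unfolding eq by (intro conjI) unfold_locales
  qed
  have ca: "distributive_lattice L" if "completely_distributive_lattice L" for L :: "'a set gorder"
  proof -
    interpret completely_distributive_lattice L by fact
    show ?thesis by unfold_locales
  qed
  have da: "distributive_lattice L" if "boolean_lattice L" for L :: "'a set gorder"
    using that by (simp add: boolean_lattice_def)
  \<comment> \<open>The cycle closes through distributivity: (a) gives (b), (b) gives (c) and (d),
    and each of these gives (a) back.\<close>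
  show ?thesis
    unfolding Let_def using ab bcd ca da by blast
qed

end
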